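(* There exists an online decide-on-arrival scheduler for the serial-parallel scheduling problem that is $3$-competitive for awake time: for every task arrival process $\mathcal{T}$, the awake time of the scheduler on $\mathcal{T}$ is at most $3$ times the awake time of the optimal offline schedule $\texttt{OPT}$ on $\mathcal{T}$.
   Context: Serial-parallel scheduling problem: there are $p$ identical processors ($p$ at least a sufficiently large constant). A task arrival process (TAP) is a finite set of tasks $\tau_1,\dots,\tau_n$; task $\tau_i$ is a triple $(\sigma_i,\pi_i,t_i)$ with arrival time $t_i\ge 0$ ($t_1\le\dots\le t_n$), serial work $\sigma_i$ and parallel work $\pi_i$, where $1\le \pi_i/\sigma_i\le p$. Each task can be performed either by its serial job (work $\sigma_i$, may run on at most one processor at any instant) or by its parallel job (work $\pi_i$, may run on any number of processors simultaneously, progressing at a rate equal to the number of processors). Time is continuous; at each instant the scheduler allocates the $p$ processors (fractionally, via time sharing) among arrived, unfinished jobs; a job completes when the integral over time of the processors allocated to it reaches its work. Before any work is done on a task the scheduler must irrevocably choose which of its two jobs to run; preemption (pausing and later resuming, possibly on other processors) is allowed. A task is alive from its arrival until its completion. The awake time of a schedule is the total measure of the set of times at which at least one task is alive. An online scheduler learns about task $\tau_i$ (its $\sigma_i,\pi_i,t_i$) only at time $t_i$ and does not know $n$ in advance; $\texttt{OPT}$ denotes an optimal offline schedule that knows the whole TAP in advance. A decide-on-arrival scheduler must, at the moment each task arrives, immediately and irrevocably decide whether to run its serial or parallel job. *)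

theory Defs
  imports "HOL-Analysis.Analysis"
begin

datatype task = Task (ser: real) (par: real) (arr: real)

text \<open>A schedule for a TAP given as a list of tasks (indices 0..n-1):
  job choice per task (True = parallel job, False = serial job) and a
  (fractional) processor allocation per task as a function of time.\<close>
record sched =
  choice :: "nat \<Rightarrow> bool"
  alloc  :: "nat \<Rightarrow> real \<Rightarrow> real"

definition valid_task :: "nat \<Rightarrow> task \<Rightarrow> bool" where
  "valid_task p x \<longleftrightarrow> ser x > 0 \<and> 1 \<le> par x / ser x \<and> par x / ser x \<le> real p \<and> arr x \<ge> 0"

definition valid_TAP :: "nat \<Rightarrow> task list \<Rightarrow> bool" where
  "valid_TAP p T \<longleftrightarrow> (\<forall>x\<in>set T. valid_task p x) \<and> sorted (map arr T)"

definition work :: "task list \<Rightarrow> sched \<Rightarrow> nat \<Rightarrow> real" where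
  "work T S i = (if choice S i then par (T ! i) else ser (T ! i))"

definition processed :: "task list \<Rightarrow> sched \<Rightarrow> nat \<Rightarrow> real \<Rightarrow> real" where
  "processed T S i c = (LINT s:{arr (T ! i)..c}|lborel. alloc S i s)"

definition valid_sched :: "nat \<Rightarrow> task list \<Rightarrow> sched \<Rightarrow> bool" where
  "valid_sched p T S \<longleftrightarrow>
     (\<forall>i < length T.
        alloc S i \<in> borel_measurable lborel \<and>
        (\<forall>s. 0 \<le> alloc S i s) \<and>
        (\<forall>s. s < arr (T ! i) \<longrightarrow> alloc S i s = 0) \<and>
        (\<not> choice S i \<longrightarrow> (\<forall>s. alloc S i s \<le> 1)) \<and>
        (\<exists>c \<ge> arr (T ! i). work T S i \<le> processed T S i c)) \<and>
     (\<forall>s. (\<Sum>i<length T. alloc S i s) \<le> real p)"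

definition completion :: "task list \<Rightarrow> sched \<Rightarrow> nat \<Rightarrow> real" where
  "completion T S i = Inf {c. arr (T ! i) \<le> c \<and> work T S i \<le> processed T S i c}"

definition awake :: "task list \<Rightarrow> sched \<Rightarrow> real" where
  "awake T S = measure lborel (\<Union>i<length T. {arr (T ! i)..<completion T S i})"

definition OPT :: "nat \<Rightarrow> task list \<Rightarrow> real" where
  "OPT p T = Inf (awake T ` {S. valid_sched p T S})"

text \<open>Tasks that have arrived by time t (a prefix of the sorted TAP).\<close>
definition arrived_by :: "task list \<Rightarrow> real \<Rightarrow> task list" where
  "arrived_by T t = takeWhile (\<lambda>x. arr x \<le> t) T"

definition online :: "nat \<Rightarrow> (task list \<Rightarrow> sched) \<Rightarrow> bool" where
  "online p A \<longleftrightarrow>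
     (\<forall>T T' t. valid_TAP p T \<longrightarrow> valid_TAP p T' \<longrightarrow> arrived_by T t = arrived_by T' t \<longrightarrow>
        (\<forall>i < length (arrived_by T t). \<forall>s \<le> t. alloc (A T) i s = alloc (A T') i s))"

definition decide_on_arrival :: "nat \<Rightarrow> (task list \<Rightarrow> sched) \<Rightarrow> bool" where
  "decide_on_arrival p A \<longleftrightarrow>
     (\<forall>T T' i. valid_TAP p T \<longrightarrow> valid_TAP p T' \<longrightarrow> i < length T \<longrightarrow>
        arrived_by T (arr (T ! i)) = arrived_by T' (arr (T ! i)) \<longrightarrow>
        choice (A T) i = choice (A T') i)"

end

theory Submission
  imports Defs
begin

text \<open>
  The scheduler keeps all \<open>p\<close> processors busy whenever a task is alive, so its awake time is the
  total work it chose, divided by \<open>p\<close>. It shares the processors in proportion to the remaining work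
  of the alive jobs, so that all of them are planned to end at one common time. A serial job then
  stays within rate 1 if its work is at most the remaining time to the common end, and the task is
  run serially exactly in this case.

  Compare with any schedule \<open>S\<close> up to a time \<open>t\<close>. If \<open>S\<close> has an unfinished task at time \<open>t\<close>, then
  \<open>S\<close> has been awake since its arrival, and one goes back to that arrival. Otherwise take the last task
  \<open>i\<close> that the scheduler ran in parallel and \<open>S\<close> serially, and let \<open>\<sigma>\<close> be its serial work.
  At its arrival the backlog was less than \<open>p \<sigma>\<close>, its parallel work is at most \<open>p \<sigma>\<close>, and the later
  tasks cost the scheduler at most what they cost \<open>S\<close>. Since \<open>S\<close> is awake for at least \<open>\<sigma>\<close> after the
  arrival of \<open>i\<close>, each of the three terms is paid for by the awake time of \<open>S\<close> after that arrival.
\<close>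

section \<open>The scheduler\<close>

text \<open>\<open>finish p T k\<close> is the time at which the first \<open>k\<close> tasks are all done if no other task arrives.\<close>

fun finish :: "nat \<Rightarrow> task list \<Rightarrow> nat \<Rightarrow> real" where
  "finish p T 0 = 0"
| "finish p T (Suc k) = max (finish p T k) (arr (T ! k)) +
     (if ser (T ! k) \<le> finish p T k - arr (T ! k) then ser (T ! k) else par (T ! k)) / real p"

definition goes_parallel :: "nat \<Rightarrow> task list \<Rightarrow> nat \<Rightarrow> bool" where
  "goes_parallel p T k \<longleftrightarrow> finish p T k - arr (T ! k) < ser (T ! k)"

definition load :: "nat \<Rightarrow> task list \<Rightarrow> nat \<Rightarrow> real" where
  "load p T k = (if goes_parallel p T k then par (T ! k) else ser (T ! k))"

text \<open>\<open>rate p T k i\<close> is the number of processors given to task \<open>i\<close> once exactly the first \<open>k\<close> tasks have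
  arrived. An arrival scales all existing rates down by the same factor.\<close>

fun rate :: "nat \<Rightarrow> task list \<Rightarrow> nat \<Rightarrow> nat \<Rightarrow> real" where
  "rate p T 0 i = 0"
| "rate p T (Suc k) i =
     (if i = k then load p T k else rate p T k i * max 0 (finish p T k - arr (T ! k)))
       / (finish p T (Suc k) - arr (T ! k))"

fun plan :: "nat \<Rightarrow> task list \<Rightarrow> nat \<Rightarrow> nat \<Rightarrow> real \<Rightarrow> real" where
  "plan p T 0 i s = 0"
| "plan p T (Suc k) i s =
     (if s < arr (T ! k) then plan p T k i s
      else if s < finish p T (Suc k) then rate p T (Suc k) i else 0)"

definition balanced_sched :: "nat \<Rightarrow> task list \<Rightarrow> sched" where
  "balanced_sched p T = \<lparr>choice = goes_parallel p T, alloc = plan p T (length T)\<rparr>"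

lemma finish_Suc: "finish p T (Suc k) = max (finish p T k) (arr (T ! k)) + load p T k / real p"
  by (simp add: load_def goes_parallel_def)

lemma rate_eq_0: "k \<le> i \<Longrightarrow> rate p T k i = 0"
  by (induction k) auto

declare finish.simps(2) [simp del]

subsection \<open>Online behaviour\<close>

lemma finish_cong: "(\<And>j. j < k \<Longrightarrow> T ! j = T' ! j) \<Longrightarrow> finish p T k = finish p T' k"
  by (induction k) (auto simp: finish.simps(2))

lemma load_cong: "(\<And>j. j \<le> k \<Longrightarrow> T ! j = T' ! j) \<Longrightarrow> load p T k = load p T' k"
  using finish_cong[of k T T' p] by (simp add: load_def goes_parallel_def)

lemma rate_cong: "(\<And>j. j < k \<Longrightarrow> T ! j = T' ! j) \<Longrightarrow> rate p T k i = rate p T' k i"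
proof (induction k)
  case (Suc k)
  then show ?case
    using finish_cong[of "Suc k" T T' p] finish_cong[of k T T' p] load_cong[of k T T' p] by simp
qed simp

lemma plan_cong: "(\<And>j. j < k \<Longrightarrow> T ! j = T' ! j) \<Longrightarrow> plan p T k i s = plan p T' k i s"
proof (induction k)
  case (Suc k)
  then show ?case
    using finish_cong[of "Suc k" T T' p] rate_cong[of "Suc k" T T' p i] by (simp del: rate.simps)
qed simp

lemma plan_eq_earlier:
  assumes "m \<le> k" "\<And>j. m \<le> j \<Longrightarrow> j < k \<Longrightarrow> s < arr (T ! j)"
  shows "plan p T k i s = plan p T m i s"
  using assms by (induction k rule: dec_induct) auto

lemma arrived_by_nth_le: "j < length (arrived_by T t) \<Longrightarrow> arr (T ! j) \<le> t"
  unfolding arrived_by_def by (metis nth_mem set_takeWhileD takeWhile_nth)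

lemma arrived_by_nth: "j < length (arrived_by T t) \<Longrightarrow> arrived_by T t ! j = T ! j"
  unfolding arrived_by_def by (simp add: takeWhile_nth)

lemma length_arrived_by_le: "length (arrived_by T t) \<le> length T"
  by (simp add: arrived_by_def length_takeWhile_le)

lemma arrived_by_nth_gt:
  assumes "sorted (map arr T)" "length (arrived_by T t) \<le> j" "j < length T"
  shows "t < arr (T ! j)"
proof -
  let ?m = "length (arrived_by T t)"
  have "\<not> arr (T ! ?m) \<le> t"
    unfolding arrived_by_def
    by (rule nth_length_takeWhile) (use assms in \<open>simp add: arrived_by_def\<close>)
  moreover have "arr (T ! ?m) \<le> arr (T ! j)"
    using assms sorted_nth_mono[of "map arr T" ?m j] by simp
  ultimately show ?thesis by simp
qed

lemma arrived_by_eq_nth: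
  assumes "arrived_by T t = arrived_by T' t" "j < length (arrived_by T t)"
  shows "T ! j = T' ! j"
  using assms arrived_by_nth by metis

lemma plan_arrived_by:
  assumes "sorted (map arr T)" "s \<le> t"
  shows "plan p T (length T) i s = plan p T (length (arrived_by T t)) i s"
  using assms arrived_by_nth_gt[OF assms(1)]
  by (intro plan_eq_earlier) (auto simp: length_arrived_by_le intro: le_less_trans)

lemma online_balanced_sched: "online p (balanced_sched p)"
  unfolding online_def
proof (intro allI impI)
  fix T T' t i and s :: real
  assume *: "valid_TAP p T" "valid_TAP p T'" "arrived_by T t = arrived_by T' t" "s \<le> t"
  then have "plan p T (length T) i s = plan p T (length (arrived_by T t)) i s"
    by (intro plan_arrived_by) (auto simp: valid_TAP_def)
  also have "\<dots> = plan p T' (length (arrived_by T t)) i s"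
    using *(3) by (intro plan_cong arrived_by_eq_nth) auto
  also have "\<dots> = plan p T' (length T') i s"
    using * by (subst plan_arrived_by[of T' s t]) (auto simp: valid_TAP_def)
  finally show "alloc (balanced_sched p T) i s = alloc (balanced_sched p T') i s"
    by (simp add: balanced_sched_def)
qed

lemma decide_on_arrival_balanced_sched: "decide_on_arrival p (balanced_sched p)"
  unfolding decide_on_arrival_def
proof (intro allI impI)
  fix T T' i
  assume *: "valid_TAP p T" "i < length T"
    "arrived_by T (arr (T ! i)) = arrived_by T' (arr (T ! i))"
  then have "i < length (arrived_by T (arr (T ! i)))"
    using arrived_by_nth_gt[of T "arr (T ! i)" i] by (force simp: valid_TAP_def)
  then have "T ! j = T' ! j" if "j \<le> i" for j
    using that *(3) by (intro arrived_by_eq_nth) auto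
  then show "choice (balanced_sched p T) i = choice (balanced_sched p T') i"
    using finish_cong[of i T T' p] by (simp add: balanced_sched_def goes_parallel_def)
qed

section \<open>Validity and awake time of the scheduler\<close>

lemma fmeasurable_Icc [simp]: "{a..b::real} \<in> fmeasurable lborel"
  by (metis box_real(2) fmeasurable_cbox)

lemma fmeasurable_Ico [simp]: "{a..<b::real} \<in> fmeasurable lborel"
  by (rule fmeasurableI2[OF fmeasurable_Icc[of a b]]) auto

lemma fmeasurable_Ioc [simp]: "{a<..b::real} \<in> fmeasurable lborel"
  by (rule fmeasurableI2[OF fmeasurable_Icc[of a b]]) auto

locale tap =
  fixes p :: nat and T :: "task list"
  assumes p_pos: "0 < p" and valid: "valid_TAP p T"
begin

abbreviation "F \<equiv> finish p T"
abbreviation "t k \<equiv> arr (T ! k)"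

section \<open>Arrival times, loads and planned finishing times\<close>

lemma arr_mono: "i \<le> j \<Longrightarrow> j < length T \<Longrightarrow> t i \<le> t j"
  using valid sorted_nth_mono[of "map arr T" i j] by (simp add: valid_TAP_def)

lemma
  assumes "k < length T"
  shows ser_pos: "0 < ser (T ! k)" and ser_le_par: "ser (T ! k) \<le> par (T ! k)"
    and par_le: "par (T ! k) \<le> real p * ser (T ! k)" and arr_nonneg: "0 \<le> t k"
  using valid assms by (auto simp: valid_TAP_def valid_task_def divide_simps dest!: nth_mem split: if_splits)

lemma load_pos: "k < length T \<Longrightarrow> 0 < load p T k"
  using ser_pos ser_le_par by (fastforce simp: load_def)

lemma finish_gt_arr: "k < length T \<Longrightarrow> t k < F (Suc k)"
  using divide_pos_pos[OF load_pos[of k], of "real p"] p_pos by (simp add: finish_Suc max_def)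

lemma finish_mono_Suc: "k < length T \<Longrightarrow> F k \<le> F (Suc k)"
  using load_pos[of k] p_pos by (simp add: finish_Suc add_increasing2)

lemma finish_mono: "i \<le> j \<Longrightarrow> j \<le> length T \<Longrightarrow> F i \<le> F j"
proof (induction j rule: dec_induct)
  case (step j)
  then show ?case using finish_mono_Suc[of j] by simp
qed simp

text \<open>Each new task moves the finish by at least its load over \<open>p\<close>; idle gaps
  only move it further.\<close>

lemma finish_ge_sum_load:
  assumes "j < m" "m \<le> length T"
  shows "max (F j) (t j) + (\<Sum>k=j..<m. load p T k) / real p \<le> F m"
  using assms
proof (induction m)
  case (Suc m)
  then show ?case
    by (cases "j = m") (auto simp: finish_Suc add_divide_distrib)
qed simp

lemma rate_nonneg: "k \<le> length T \<Longrightarrow> 0 \<le> rate p T k i"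
proof (induction k)
  case (Suc k)
  then show ?case
    using finish_gt_arr[of k] load_pos[of k] by (auto intro!: divide_nonneg_pos mult_nonneg_nonneg)
qed simp

text \<open>At arrival \<open>k\<close> the old jobs have remaining work
  \<open>p * max 0 (F k - t k)\<close> and the new one \<open>load p T k\<close>; together this is
  exactly \<open>p\<close> times the time left until \<open>F (Suc k)\<close>.\<close>

lemma sum_rate:
  assumes "0 < k" "k \<le> length T"
  shows "(\<Sum>i<k. rate p T k i) = real p"
  using assms
proof (induction k)
  case (Suc k)
  \<comment> \<open>For \<open>k = 0\<close> the sum is empty, but \<open>F 0 = 0\<close> is at most
    \<open>t 0\<close>, so both sides vanish.\<close>
  have sum: "(\<Sum>i<k. rate p T k i) * max 0 (F k - t k) = real p * max 0 (F k - t k)"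
    using Suc arr_nonneg[of k] by (cases "k = 0") (auto simp: max_def Suc_le_eq)
  have "(\<Sum>i<Suc k. rate p T (Suc k) i) =
      ((\<Sum>i<k. rate p T k i) * max 0 (F k - t k) + load p T k) / (F (Suc k) - t k)"
    by (simp add: sum_distrib_right sum_divide_distrib add_divide_distrib)
  also have "\<dots> = real p * (max 0 (F k - t k) + load p T k / real p) / (F (Suc k) - t k)"
    using p_pos by (simp add: sum distrib_left)
  also have "max 0 (F k - t k) + load p T k / real p = F (Suc k) - t k"
    by (simp add: finish_Suc max_def)
  finally show ?case
    using finish_gt_arr[of k] Suc.prems by simp
qed simp

text \<open>The serial test bounds the initial rate by 1, and every later arrival multiplies it by a
  factor of at most 1.\<close>

lemma rate_serial_le_1:
  assumes "\<not> goes_parallel p T i" "k \<le> length T"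
  shows "rate p T k i \<le> 1"
  using assms(2)
proof (induction k)
  case (Suc k)
  have gt: "t k < F (Suc k)" and le: "F k \<le> F (Suc k)"
    using Suc finish_gt_arr finish_mono_Suc by auto
  show ?case
  proof (cases "i = k")
    case True
    then have "load p T k \<le> F (Suc k) - t k"
      using assms le by (simp add: load_def goes_parallel_def)
    then show ?thesis using True gt by simp
  next
    case False
    have "rate p T k i * max 0 (F k - t k) \<le> 1 * (F (Suc k) - t k)"
      using Suc rate_nonneg[of k i] gt le by (intro mult_mono) auto
    then show ?thesis using False gt by simp
  qed
qed simp

lemma plan_from_last_arrival:
  assumes "k < length T" "t k \<le> s"
  shows "plan p T k i s = (if s < F k then rate p T k i else 0)"
proof (cases k)
  case (Suc k')
  then show ?thesis using assms arr_mono[of k' k] by auto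
qed simp

text \<open>Expresses an arrival as an exchange of constant pieces, so that integrals of the plan
  follow by induction.\<close>

lemma plan_Suc_diff:
  assumes "k < length T"
  shows "plan p T (Suc k) i s = plan p T k i s + rate p T (Suc k) i * indicator {t k..<F (Suc k)} s
           - rate p T k i * indicator {t k..<F k} s"
  using plan_from_last_arrival[OF assms, of s i] by (auto simp: indicator_def simp del: rate.simps)

lemma plan_nonneg: "k \<le> length T \<Longrightarrow> 0 \<le> plan p T k i s"
  by (induction k) (use rate_nonneg in \<open>auto simp del: rate.simps\<close>)

lemma plan_serial_le_1: "\<not> goes_parallel p T i \<Longrightarrow> k \<le> length T \<Longrightarrow> plan p T k i s \<le> 1"
  by (induction k) (use rate_serial_le_1 in \<open>auto simp del: rate.simps\<close>)

lemma plan_eq_0_not_arrived: "k \<le> i \<Longrightarrow> plan p T k i s = 0"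
  by (induction k) (auto simp: rate_eq_0 simp del: rate.simps)

lemma plan_eq_0_before:
  assumes "s < t i" "k \<le> length T"
  shows "plan p T k i s = 0"
  using assms(2)
proof (induction k)
  case (Suc k)
  show ?case
  proof (cases "s < t k")
    case False
    then have "k < i" using assms arr_mono[of i k] Suc by force
    then show ?thesis by (simp add: plan_eq_0_not_arrived del: plan.simps)
  qed (use Suc in simp)
qed simp

lemma plan_eq_0_after:
  assumes "F k \<le> s" "k \<le> length T"
  shows "plan p T k i s = 0"
proof (cases k)
  case (Suc k')
  then show ?thesis using assms finish_gt_arr[of k'] by simp
qed simp

lemma sum_plan_le: "k \<le> length T \<Longrightarrow> (\<Sum>i<k. plan p T k i s) \<le> real p"
proof (induction k)
  case (Suc k)
  then show ?case
    using sum_rate[of "Suc k"]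
    by (cases "s < t k") (simp_all add: plan_eq_0_not_arrived del: rate.simps)
qed simp

text \<open>An arrival spreads the remaining work \<open>rate p T k i * max 0 (F k - t k)\<close> of
  an old job over the time until the new finish, so its integral is unchanged.\<close>

lemma has_integral_plan:
  assumes "k \<le> length T"
  shows "has_bochner_integral lborel (plan p T k i) (if i < k then load p T i else 0)"
  using assms
proof (induction k)
  case (Suc k)
  have ind: "has_bochner_integral lborel (\<lambda>s. c * indicator {t k..<b} s) (c * max 0 (b - t k))"
    for c b :: real
    using has_bochner_integral_real_indicator[of "{t k..<b}" lborel] fmeasurableD2[OF fmeasurable_Ico]
    by (intro has_bochner_integral_mult_right) (auto simp: max_def less_top split: if_splits)
  have gt: "t k < F (Suc k)" using Suc finish_gt_arr by simp
  have "has_bochner_integral lborel (plan p T (Suc k) i)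
      ((if i < k then load p T i else 0) + rate p T (Suc k) i * max 0 (F (Suc k) - t k)
        - rate p T k i * max 0 (F k - t k))"
    unfolding plan_Suc_diff[OF Suc_le_lessD[OF Suc.prems], abs_def]
    using Suc by (intro has_bochner_integral_diff has_bochner_integral_add ind) auto
  also have "(if i < k then load p T i else 0) + rate p T (Suc k) i * max 0 (F (Suc k) - t k)
        - rate p T k i * max 0 (F k - t k) = (if i < Suc k then load p T i else 0)"
    using gt rate_eq_0[of k i p T] by (cases i k rule: linorder_cases) auto
  finally show ?case .
next
  case 0
  have "plan p T 0 i = (\<lambda>s. 0)" by auto
  then show ?case by (simp add: has_bochner_integral_zero)
qed

lemma processed_plan:
  assumes "i < m" "m \<le> length T" "F m \<le> c" "\<And>j. m \<le> j \<Longrightarrow> j < length T \<Longrightarrow> c < t j"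
  shows "processed T (balanced_sched p T) i c = load p T i"
proof -
  \<comment> \<open>The plan for the first \<open>m\<close> tasks vanishes before \<open>t i\<close>
    and from \<open>F m\<close> on, so cutting to \<open>{t i..c}\<close> loses nothing.\<close>
  have "indicator {t i..c} s *\<^sub>R plan p T (length T) i s = plan p T m i s" for s
  proof (cases "s \<in> {t i..c}")
    case True
    have "plan p T (length T) i s = plan p T m i s"
      using True assms(2) assms(4) by (intro plan_eq_earlier) force+
    then show ?thesis using True by simp
  next
    case False
    then have "s < t i \<or> F m \<le> s" using assms by auto
    then show ?thesis using False assms(2) plan_eq_0_before plan_eq_0_after by auto
  qed
  then show ?thesis
    using has_integral_plan[OF assms(2), of i] assms(1)
    by (simp add: processed_def balanced_sched_def set_lebesgue_integral_def has_bochner_integral_integral_eq)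
qed

lemma work_balanced_sched: "work T (balanced_sched p T) i = load p T i"
  by (simp add: work_def load_def balanced_sched_def)

lemma valid_balanced_sched: "valid_sched p T (balanced_sched p T)"
proof -
  have "\<exists>c\<ge>t i. work T (balanced_sched p T) i \<le> processed T (balanced_sched p T) i c"
    if "i < length T" for i
    using that processed_plan[of i "length T" "max (t i) (F (length T))"]
    by (intro exI[of _ "max (t i) (F (length T))"]) (simp add: work_balanced_sched)
  moreover have "plan p T (length T) i \<in> borel_measurable lborel" for i
    using has_integral_plan[of "length T" i] borel_measurable_has_bochner_integral by blast
  ultimately show ?thesis
    unfolding valid_sched_def
    by (auto simp: balanced_sched_def plan_nonneg plan_eq_0_before plan_serial_le_1 sum_plan_le)
qed

section \<open>Awake time of the scheduler\<close>

lemma alive_imp_busy: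
  assumes i: "i < length T" and s: "t i \<le> s" "s < completion T (balanced_sched p T) i"
  shows "\<exists>k<length T. t k \<le> s \<and> s < F (Suc k)"
proof (rule ccontr)
  assume *: "\<not> ?thesis"
  define m where "m = length (arrived_by T s)"
  have later: "s < t j" if "m \<le> j" "j < length T" for j
    using arrived_by_nth_gt[of T s j] that valid by (simp add: m_def valid_TAP_def)
  have m: "i < m" "m \<le> length T"
    using later[of i] i s by (force, simp add: m_def length_arrived_by_le)
  have "t (m - 1) \<le> s"
    using m by (intro arrived_by_nth_le) (simp add: m_def)
  \<comment> \<open>The assumption is applied to \<open>m - 1\<close>, the last task to arrive by
    \<open>s\<close>.\<close>
  then have "F m \<le> s" using * m by (cases m) auto
  then have "processed T (balanced_sched p T) i s = load p T i"
    using m later by (intro processed_plan) auto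
  then have "completion T (balanced_sched p T) i \<le> s"
    unfolding completion_def using s
    by (intro cInf_lower bdd_belowI[of _ "t i"]) (auto simp: work_balanced_sched)
  then show False using s by simp
qed

text \<open>The intervals start at \<open>F 0 = 0\<close>, and a gap from \<open>F k\<close> to
  \<open>t k\<close> cannot contain \<open>s\<close>, because \<open>t k \<le> s\<close>.\<close>

lemma busy_at_some_step:
  assumes "m \<le> length T" "0 \<le> s" "s < F m" "\<And>k. k < m \<Longrightarrow> t k \<le> s"
  shows "\<exists>k<m. max (F k) (t k) \<le> s \<and> s < F (Suc k)"
  using assms
proof (induction m)
  case (Suc m)
  then show ?case by (cases "s < F m") (force simp: less_Suc_eq)+
qed simp

lemma awake_balanced_sched_le:
  "awake T (balanced_sched p T) \<le> (\<Sum>k<length T. load p T k) / real p"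
proof -
  let ?I = "\<lambda>k. {max (F k) (t k)..<F (Suc k)}"
  have "(\<Union>i<length T. {t i..<completion T (balanced_sched p T) i}) \<subseteq> (\<Union>k<length T. ?I k)"
  proof
    fix s assume "s \<in> (\<Union>i<length T. {t i..<completion T (balanced_sched p T) i})"
    then obtain k where k: "k < length T" "t k \<le> s" "s < F (Suc k)"
      using alive_imp_busy by auto
    then have "\<exists>j<Suc k. max (F j) (t j) \<le> s \<and> s < F (Suc j)"
      using order_trans[OF arr_nonneg, of k s] arr_mono[THEN order_trans, of _ k s]
      by (intro busy_at_some_step) auto
    then show "s \<in> (\<Union>k<length T. ?I k)" using k by force
  qed
  then have "awake T (balanced_sched p T) \<le> measure lborel (\<Union>k<length T. ?I k)"
    unfolding awake_def by (intro measure_mono_fmeasurable fmeasurable.finite_UN) auto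
  also have "\<dots> \<le> (\<Sum>k<length T. measure lborel (?I k))"
    by (intro measure_UNION_le) auto
  also have "\<dots> = (\<Sum>k<length T. load p T k / real p)"
    using load_pos p_pos by (intro sum.cong) (auto simp: finish_Suc less_imp_le)
  finally show ?thesis by (simp add: sum_divide_distrib)
qed

section \<open>Comparison with an arbitrary schedule\<close>

context
  fixes S :: sched
  assumes S: "valid_sched p T S"
begin

abbreviation "C \<equiv> completion T S"

definition awake_in :: "real \<Rightarrow> real \<Rightarrow> real" where
  "awake_in a b = measure lborel ((\<Union>i<length T. {t i..<C i}) \<inter> {a..<b})"

section \<open>Processed work and completion times of \<open>S\<close>\<close>

lemma alloc_le:
  assumes "i < length T"
  shows "alloc S i s \<le> real p"
proof -
  have "alloc S i s \<le> (\<Sum>i<length T. alloc S i s)"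
    using S assms by (intro member_le_sum) (auto simp: valid_sched_def)
  also have "\<dots> \<le> real p" using S by (simp add: valid_sched_def)
  finally show ?thesis .
qed

lemma set_integrable_alloc:
  assumes "i < length T" "A \<in> fmeasurable lborel"
  shows "set_integrable lborel A (alloc S i)"
  unfolding set_integrable_def
proof (rule integrableI_bounded_set[where A = A and B = "real p"])
  show "AE x in lborel. x \<in> A \<longrightarrow> norm (indicator A x *\<^sub>R alloc S i x) \<le> real p"
    using S assms alloc_le[of i] by (auto simp: valid_sched_def)
qed (use assms S in \<open>auto simp: valid_sched_def fmeasurable_def\<close>)

lemma processed_diff_le:
  assumes i: "i < length T" and b: "\<And>s. alloc S i s \<le> b" and "t i \<le> c" "c \<le> d"
  shows "processed T S i d \<le> processed T S i c + b * (d - c)"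
proof -
  have "processed T S i d = processed T S i c + (LINT s:{c<..d}|lborel. alloc S i s)"
    unfolding processed_def using assms
    by (subst set_integral_Un[symmetric])
       (auto simp: ivl_disj_un intro!: set_integrable_alloc)
  also have "(LINT s:{c<..d}|lborel. alloc S i s) \<le> (LINT s:{c<..d}|lborel. b)"
    using assms by (intro set_integral_mono set_integrable_alloc) (auto simp: set_integrable_def fmeasurable_def)
  also have "\<dots> = b * (d - c)"
    using assms by (simp add: set_lebesgue_integral_def)
  finally show ?thesis by simp
qed

lemma completion_set_nonempty: "i < length T \<Longrightarrow> {c. t i \<le> c \<and> work T S i \<le> processed T S i c} \<noteq> {}"
  using S by (auto simp: valid_sched_def)

lemma arr_le_completion: "i < length T \<Longrightarrow> t i \<le> C i"
  unfolding completion_def by (intro cInf_greatest completion_set_nonempty) auto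

lemma serial_le_completion:
  assumes "i < length T" "\<not> choice S i"
  shows "t i + ser (T ! i) \<le> C i"
  unfolding completion_def
proof (intro cInf_greatest completion_set_nonempty assms)
  fix c assume c: "c \<in> {c. t i \<le> c \<and> work T S i \<le> processed T S i c}"
  have "processed T S i (t i) = 0"
    using AE_lborel_singleton[of "t i"] unfolding processed_def set_lebesgue_integral_def
    by (intro integral_eq_zero_AE) (auto elim!: eventually_mono)
  then show "t i + ser (T ! i) \<le> c"
    using processed_diff_le[of i 1 "t i" c] S assms c by (auto simp: valid_sched_def work_def)
qed

text \<open>The infimum defining \<open>C i\<close> is attained, because processed work is Lipschitz
  in time with constant \<open>p\<close>.\<close>

lemma work_le_processed_completion:
  assumes i: "i < length T"
  shows "work T S i \<le> processed T S i (C i)"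
proof (rule field_le_epsilon)
  fix e :: real assume "0 < e"
  then have "C i < C i + e / real p" using p_pos by simp
  then obtain c where c: "t i \<le> c" "work T S i \<le> processed T S i c" "c < C i + e / real p"
    using cInf_lessD[OF completion_set_nonempty[OF i], of "C i + e / real p"]
    unfolding completion_def by blast
  have "C i \<le> c"
    unfolding completion_def using c by (intro cInf_lower bdd_belowI[of _ "t i"]) auto
  then have "processed T S i c \<le> processed T S i (C i) + real p * (c - C i)"
    using i arr_le_completion alloc_le by (intro processed_diff_le) auto
  moreover have "real p * (c - C i) \<le> e"
    using c p_pos by (simp add: field_simps)
  ultimately show "work T S i \<le> processed T S i (C i) + e" using c by simp
qed

text \<open>The tasks of \<open>K\<close> are alive only at awake times of \<open>S\<close> in
  \<open>[a, b)\<close>, and at each instant they share at most \<open>p\<close> processors.\<close>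

lemma sum_work_le_awake_in:
  assumes K: "K \<subseteq> {..<length T}" "\<And>k. k \<in> K \<Longrightarrow> a \<le> t k \<and> C k \<le> b"
  shows "(\<Sum>k\<in>K. work T S k) \<le> real p * awake_in a b"
proof -
  let ?U = "(\<Union>i<length T. {t i..<C i}) \<inter> {a..<b}"
  have fin: "finite K" using K(1) finite_subset by blast
  have U: "?U \<in> fmeasurable lborel"
    by (intro fmeasurable_Int_fmeasurable fmeasurable.finite_UN) auto
  \<comment> \<open>Dropping the null set \<open>{C k}\<close> matches the half-open intervals in
    the definition of awake time.\<close>
  have "processed T S k (C k) = (LINT s:{t k..<C k}|lborel. alloc S k s)" if "k \<in> K" for k
    unfolding processed_def set_lebesgue_integral_def
    using that K(1) S AE_lborel_singleton[of "C k"]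
    by (intro integral_cong_AE) (auto simp: valid_sched_def indicator_def elim!: eventually_mono)
  then have "(\<Sum>k\<in>K. work T S k) \<le> (\<Sum>k\<in>K. (LINT s:{t k..<C k}|lborel. alloc S k s))"
    using K(1) work_le_processed_completion by (intro sum_mono) force
  also have "\<dots> = (LINT s|lborel. (\<Sum>k\<in>K. indicator {t k..<C k} s *\<^sub>R alloc S k s))"
    unfolding set_lebesgue_integral_def
    using K(1) set_integrable_alloc[OF _ fmeasurable_Ico]
    by (subst Bochner_Integration.integral_sum) (auto simp: set_integrable_def)
  also have "\<dots> \<le> (LINT s|lborel. real p * indicator ?U s)"
  proof (rule integral_mono)
    show "integrable lborel (\<lambda>s. \<Sum>k\<in>K. indicator {t k..<C k} s *\<^sub>R alloc S k s)"
      using K(1) set_integrable_alloc[OF _ fmeasurable_Ico]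
      by (intro Bochner_Integration.integrable_sum) (auto simp: set_integrable_def)
    show "integrable lborel (\<lambda>s. real p * indicator ?U s)"
      using U by (intro integrable_mult_right integrable_real_indicator) (auto simp: fmeasurable_def)
    fix s :: real
    show "(\<Sum>k\<in>K. indicator {t k..<C k} s *\<^sub>R alloc S k s) \<le> real p * indicator ?U s"
    proof (cases "s \<in> ?U")
      case True
      have "(\<Sum>k\<in>K. indicator {t k..<C k} s *\<^sub>R alloc S k s) \<le> (\<Sum>k<length T. alloc S k s)"
        using K(1) fin S by (intro sum_le_included[where i = id]) (auto simp: valid_sched_def indicator_def)
      also have "\<dots> \<le> real p" using S by (simp add: valid_sched_def)
      finally show ?thesis using True by simp
    next
      case False
      have "indicator {t k..<C k} s *\<^sub>R alloc S k s = 0" if "k \<in> K" for k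
        using False K(1) K(2)[OF that] that by (auto simp: indicator_def)
      then have "(\<Sum>k\<in>K. indicator {t k..<C k} s *\<^sub>R alloc S k s) = 0" by (rule sum.neutral[OF ballI])
      then show ?thesis by simp
    qed
  qed
  also have "\<dots> = real p * awake_in a b"
    unfolding awake_in_def by (simp only: integral_mult_right_zero integral_indicator) simp
  finally show ?thesis .
qed

lemma awake_in_nonneg: "0 \<le> awake_in a b"
  by (simp add: awake_in_def)

lemma awake_in_split:
  assumes "a \<le> b" "b \<le> c"
  shows "awake_in a c = awake_in a b + awake_in b c"
proof -
  let ?O = "\<Union>i<length T. {t i..<C i}"
  have "?O \<inter> {a..<c} = (?O \<inter> {a..<b}) \<union> (?O \<inter> {b..<c})"
    using assms by auto
  moreover have "?O \<inter> {x..<y} \<in> fmeasurable lborel" for x y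
    by (intro fmeasurable_Int_fmeasurable fmeasurable.finite_UN) auto
  moreover have "(?O \<inter> {a..<b}) \<inter> (?O \<inter> {b..<c}) = {}" by auto
  ultimately show ?thesis
    unfolding awake_in_def by (simp only:) (simp add: measure_Un3)
qed

lemma awake_in_alive:
  assumes "i < length T" "t i \<le> b" "b \<le> C i"
  shows "awake_in (t i) b = b - t i"
proof -
  have "(\<Union>i<length T. {t i..<C i}) \<inter> {t i..<b} = {t i..<b}"
    using assms by force
  then show ?thesis using assms by (simp add: awake_in_def)
qed

lemma awake_in_le_awake: "awake_in a b \<le> awake T S"
  unfolding awake_in_def awake_def
  by (intro measure_mono_fmeasurable fmeasurable.finite_UN) auto

text \<open>The left-hand side is the time that the scheduler, given the first \<open>m\<close> tasks only, is awake
  before \<open>b\<close>.\<close>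

lemma busy_before_le_3_awake:
  assumes "m \<le> length T" "0 \<le> b" "\<And>k. k < m \<Longrightarrow> t k \<le> b"
  shows "(\<Sum>k<m. load p T k) / real p - max 0 (F m - b) \<le> 3 * awake_in 0 b"
  using assms
\<comment> \<open>\<open>b\<close> is arbitrary because the hypothesis is used for the first
  \<open>j\<close> tasks at the earlier time \<open>t j\<close>.\<close>
proof (induction m arbitrary: b rule: less_induct)
  case (less m)
  have IH: "(\<Sum>k<j. load p T k) / real p - max 0 (F j - t j) \<le> 3 * awake_in 0 (t j)"
    if "j < m" for j
    using that less.prems arr_nonneg arr_mono by (intro less.IH) auto
  have split: "awake_in 0 b = awake_in 0 (t j) + awake_in (t j) b" if "j < m" for j
    using that less.prems arr_nonneg by (intro awake_in_split) auto
  have sum_split: "(\<Sum>k<m. load p T k) / real p =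
      (\<Sum>k<j. load p T k) / real p + (\<Sum>k=j..<m. load p T k) / real p" if "j \<le> m" for j
    using that by (simp add: add_divide_distrib[symmetric] lessThan_atLeast0 sum.atLeastLessThan_concat)
  consider (alive) j where "j < m" "b < C j"
    | (last) i where "i < m" "goes_parallel p T i" "\<not> choice S i"
        "\<And>k. i < k \<Longrightarrow> k < m \<Longrightarrow> goes_parallel p T k \<Longrightarrow> choice S k" "\<And>k. k < m \<Longrightarrow> C k \<le> b"
    | (none) "\<And>k. k < m \<Longrightarrow> goes_parallel p T k \<Longrightarrow> choice S k" "\<And>k. k < m \<Longrightarrow> C k \<le> b"
  proof -
    let ?B = "{k. k < m \<and> goes_parallel p T k \<and> \<not> choice S k}"
    have fin: "finite ?B" by simp
    show ?thesis
    proof (cases "\<exists>j<m. b < C j")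
      case False
      show ?thesis
      proof (cases "?B = {}")
        case True
        then show ?thesis using False none by force
      next
        case nonempty: False
        then obtain i where "i \<in> ?B" "\<And>k. k \<in> ?B \<Longrightarrow> k \<le> i"
          using that[of "Max ?B"] Max_in[OF fin] Max_ge[OF fin] by blast
        then show ?thesis
          using False by (intro last[of i]) (auto simp: not_less dest: leD)
      qed
    qed (use alive in blast)
  qed
  then show ?case
  proof cases
    case alive
    \<comment> \<open>The loads from \<open>j\<close> on, divided by \<open>p\<close>, sum to at
      most \<open>F m - max (F j) (t j)\<close>. So from \<open>t j\<close> to \<open>b\<close> the
      left-hand side grows by at most \<open>b - t j\<close>, all of it awake time of
      \<open>S\<close>.\<close>
    then have "awake_in (t j) b = b - t j"
      using less.prems by (intro awake_in_alive) auto
    moreover have "t j \<le> b" using alive less.prems by simp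
    ultimately show ?thesis
      using IH[of j] split[of j] sum_split[of j] finish_ge_sum_load[of j m] alive less.prems(1)
      by linarith
  next
    case last
    let ?O = "awake_in (t i) b" and ?s = "ser (T ! i)"
    have i: "i < length T" using last less.prems by simp
    have "awake_in (t i) b = awake_in (t i) (C i) + awake_in (C i) b"
      using last i arr_le_completion by (intro awake_in_split) auto
    then have s: "?s \<le> ?O"
      using awake_in_alive[of i "C i"] awake_in_nonneg[of "C i" b] serial_le_completion[of i]
        arr_le_completion[of i] last i by simp
    \<comment> \<open>As \<open>i\<close> is the last such task, a later parallel load is also
      parallel in \<open>S\<close>; a serial load is at most either work.\<close>
    have "(\<Sum>k=Suc i..<m. load p T k) \<le> (\<Sum>k=Suc i..<m. work T S k)"
      using last(4) less.prems ser_le_par by (intro sum_mono) (auto simp: load_def work_def)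
    also have "\<dots> \<le> real p * ?O"
      using last less.prems arr_mono[of i] by (intro sum_work_le_awake_in) auto
    finally have "(\<Sum>k=Suc i..<m. load p T k) / real p \<le> ?O"
      using p_pos by (simp add: field_simps)
    moreover have "load p T i / real p \<le> ?s"
      using last par_le[OF i] p_pos by (simp add: load_def field_simps)
    moreover have "(\<Sum>k=i..<m. load p T k) / real p
        = load p T i / real p + (\<Sum>k=Suc i..<m. load p T k) / real p"
      using last by (simp add: sum.atLeast_Suc_lessThan add_divide_distrib)
    moreover have "max 0 (F i - t i) \<le> ?s"
      using last ser_pos[OF i] by (simp add: goes_parallel_def)
    \<comment> \<open>Backlog at \<open>t i\<close>, load of \<open>i\<close> and later loads, each
      divided by \<open>p\<close> where it is work, are at most \<open>?O\<close> each: this gives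
      the factor 3.\<close>
    ultimately show ?thesis
      using IH[of i] split[of i] sum_split[of i] s last(1) by linarith
  next
    case none
    have "(\<Sum>k<m. load p T k) \<le> (\<Sum>k<m. work T S k)"
      using none(1) less.prems(1) ser_le_par by (intro sum_mono) (auto simp: load_def work_def)
    also have "\<dots> \<le> real p * awake_in 0 b"
      using none(2) less.prems(1) arr_nonneg by (intro sum_work_le_awake_in) auto
    finally have "(\<Sum>k<m. load p T k) / real p \<le> awake_in 0 b"
      using p_pos by (simp add: field_simps)
    then show ?thesis using awake_in_nonneg[of 0 b] by simp
  qed
qed

lemma awake_balanced_sched_le_3_awake: "awake T (balanced_sched p T) \<le> 3 * awake T S"
proof -
  let ?n = "length T"
  have "0 \<le> F ?n" using finish_mono[of 0 ?n] by simp
  moreover have "t k \<le> F ?n" if "k < ?n" for k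
    using finish_gt_arr[OF that] finish_mono[of "Suc k" ?n] that by simp
  \<comment> \<open>At \<open>b = F ?n\<close> the subtracted term is zero and the left-hand side is
    the total load over \<open>p\<close>.\<close>
  ultimately show ?thesis
    using busy_before_le_3_awake[of ?n "F ?n"] awake_balanced_sched_le awake_in_le_awake[of 0 "F ?n"]
    by simp
qed

end

lemma awake_balanced_sched_le_3_OPT: "awake T (balanced_sched p T) \<le> 3 * OPT p T"
proof -
  \<comment> \<open>The infimum is over a nonempty set, since \<open>balanced_sched p T\<close>
    itself is valid.\<close>
  have "awake T (balanced_sched p T) / 3 \<le> OPT p T"
    unfolding OPT_def using valid_balanced_sched awake_balanced_sched_le_3_awake
    by (intro cInf_greatest) (auto simp: field_simps)
  then show ?thesis by simp
qed

end

theorem theorem4p2: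
  shows "\<exists>p0::nat. \<forall>p \<ge> p0. \<exists>A :: task list \<Rightarrow> sched.
           online p A \<and> decide_on_arrival p A \<and>
           (\<forall>T. valid_TAP p T \<longrightarrow> valid_sched p T (A T) \<and> awake T (A T) \<le> 3 * OPT p T)"
\<comment> \<open>The threshold 1 ensures that \<open>p\<close> is positive, so that loads can be
  divided by it.\<close>
proof (intro exI[of _ 1] allI impI)
  fix p :: nat
  assume "1 \<le> p"
  then have tap: "tap p T" if "valid_TAP p T" for T
    using that by unfold_locales auto
  show "\<exists>A. online p A \<and> decide_on_arrival p A \<and>
      (\<forall>T. valid_TAP p T \<longrightarrow> valid_sched p T (A T) \<and> awake T (A T) \<le> 3 * OPT p T)"
    using online_balanced_sched decide_on_arrival_balanced_sched
      tap.valid_balanced_sched[OF tap] tap.awake_balanced_sched_le_3_OPT[OF tap]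
    by (intro exI[of _ "balanced_sched p"]) blast
qed

end
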